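(* Let $d=1$, let $$\Delta=\mathrm{conv}\{-e_0+2e_1,\ 2e_0-e_1,\ -e_0-e_1\}$$ (the moment polytope of $\mathbb P^2$), and let $h:\Delta\cap M\to\mathbb Z$ be the height function with $h(0)=0$, $h(-e_0+2e_1)=9$, $h(-e_0+e_1)=5$, $h(e_1)=5$, and $h(-e_0)=h(e_0)=h(-e_0-e_1)=h(-e_1)=h(e_0-e_1)=h(2e_0-e_1)=1$. Let $\nu=c\,\nu_N$ with $c=\mu_M(A)/\nu_N(B)$. Then the equation $\mathrm{MA}(\Psi|_{B^\circ})=\nu$ does not admit a solution $\Psi\in\mathcal P(\Delta)$.
   Context: $M\cong\mathbb Z^2$ is a lattice with basis $e_0,e_1$, $N=\mathrm{Hom}(M,\mathbb Z)$, $M_{\mathbb R},N_{\mathbb R}$ the real vector spaces with pairing $\langle\cdot,\cdot\rangle$. $\Delta_h^\vee=\{n\in N_{\mathbb R}:\langle m,n\rangle\le h(m)\ \forall m\in\Delta\cap M\}$, $A=\partial\Delta$, $B=\partial\Delta_h^\vee$; $B^\circ$ is the union of the relative interiors $\tau^\circ$ of the facets (edges) $\tau$ of $\Delta_h^\vee$. For a facet $\sigma$ of $\Delta$, $n_\sigma\in N$ is its primitive outward normal; for a facet $\tau$ of $\Delta_h^\vee$, $m_\tau\in\Delta\cap M$ is its primitive outward normal. $\mu_M$ (resp. $\nu_N$) is the measure on $A$ (resp. $B$) equal on each facet $\sigma$ (resp. $\tau$) to Lebesgue (length) measure normalized by the lattice $n_\sigma^\perp\cap M$ (resp. $m_\tau^\perp\cap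 N$). $\mathcal P(\Delta)$ is the set of convex $\Psi:N_{\mathbb R}\to\mathbb R$ with $\sup_n|\Psi(n)-\sup_{m\in\Delta\cap M}\langle m,n\rangle|<\infty$. For a facet $\sigma$ of $\Delta$, $\beta_\sigma(n)=\langle m_1,n\rangle\in\mathbb R$ for a generator $m_1$ of $n_\sigma^\perp\cap M$. $\mathrm{MA}(\Psi|_{B^\circ})=\nu$ means: for every facet $\tau$ of $\Delta_h^\vee$, facet $\sigma$ of $\Delta$ with $m_\tau\in\sigma$, and measurable $E\subset\tau^\circ$, $|\partial(\Psi\circ\beta_\sigma^{-1})(\beta_\sigma(E))|=\nu(E)$, where $\beta_\sigma^{-1}$ is the inverse of $\beta_\sigma|_{\tau^\circ}$, $\partial$ is the subgradient of the convex function $\Psi\circ\beta_\sigma^{-1}$ on $\beta_\sigma(\tau^\circ)$, and $|\cdot|$ is Lebesgue measure. *)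

theory Defs
  imports "HOL-Analysis.Analysis"
begin

text \<open>
  Both M_R and N_R are modelled by the plane: M_R in coordinates with respect to the basis
  e0, e1, and N_R in coordinates with respect to the dual basis.  The pairing between them is
  then the inner product.
\<close>

type_synonym plane = "real \<times> real"

definition e0 :: plane where "e0 = (1, 0)"

definition e1 :: plane where "e1 = (0, 1)"

definition lat_M :: "plane set" where
  "lat_M = {of_int a *\<^sub>R e0 + of_int b *\<^sub>R e1 | a b :: int. True}"

definition lat_N :: "plane set" where
  "lat_N = {n. \<forall>m\<in>lat_M. m \<bullet> n \<in> \<int>}"

definition dual_body :: "plane set \<Rightarrow> (plane \<Rightarrow> int) \<Rightarrow> plane set" where
  "dual_body \<Delta> h = {n. \<forall>m \<in> \<Delta> \<inter> lat_M. m \<bullet> n \<le> of_int (h m)}"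

definition primitive_in :: "plane set \<Rightarrow> plane \<Rightarrow> bool" where
  "primitive_in L v \<longleftrightarrow>
     v \<in> L \<and> (\<forall>w\<in>L. \<forall>k::int. v = of_int k *\<^sub>R w \<longrightarrow> \<bar>k\<bar> = 1)"

definition outward_normal :: "plane set \<Rightarrow> plane set \<Rightarrow> plane \<Rightarrow> bool" where
  "outward_normal P F v \<longleftrightarrow>
     (\<exists>a. (\<forall>x\<in>P. v \<bullet> x \<le> a) \<and> F = {x\<in>P. v \<bullet> x = a})"

text \<open>Well defined if the polygon P has nonempty interior and the facet F a rational normal
  direction.  The lattice K is the one dual to the lattice of the plane containing P.\<close>

definition prim_normal :: "plane set \<Rightarrow> plane set \<Rightarrow> plane set \<Rightarrow> plane" where
  "prim_normal K P F = (THE v. primitive_in K v \<and> outward_normal P F v)"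

definition perp_lattice :: "plane set \<Rightarrow> plane \<Rightarrow> plane set" where
  "perp_lattice L v = {w\<in>L. w \<bullet> v = 0}"

text \<open>A generator of a lattice of rank one, determined up to sign.\<close>

definition lattice_gen :: "plane set \<Rightarrow> plane" where
  "lattice_gen G = (SOME g. G = range (\<lambda>k::int. of_int k *\<^sub>R g))"

text \<open>Lebesgue measure on the line through F parallel to the rank one lattice G, normalized so
  that the segment from 0 to a generator of G has length 1.  By translation and reflection
  invariance it depends neither on the base point in F nor on the generator.\<close>

definition lattice_length :: "plane set \<Rightarrow> plane set \<Rightarrow> plane measure" where
  "lattice_length G F =
     distr lborel borel (\<lambda>t. (SOME x. x \<in> F) + t *\<^sub>R lattice_gen G)"

text \<open>Facets overlap only in vertices, which are null sets, so that summing over the facets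
  gives the measure on the boundary that restricts to the lattice length on every facet.\<close>

definition boundary_measure :: "plane set \<Rightarrow> plane set \<Rightarrow> plane set \<Rightarrow> plane measure" where
  "boundary_measure L K P =
     measure_of (frontier P) (sets (restrict_space borel (frontier P)))
       (\<lambda>E. \<Sum>F | F facet_of P.
          emeasure (lattice_length (perp_lattice L (prim_normal K P F)) F) (E \<inter> F))"

definition mu_M :: "plane set \<Rightarrow> plane measure" where
  "mu_M \<Delta> = boundary_measure lat_M lat_N \<Delta>"

definition nu_N :: "plane set \<Rightarrow> (plane \<Rightarrow> int) \<Rightarrow> plane measure" where
  "nu_N \<Delta> h = boundary_measure lat_N lat_M (dual_body \<Delta> h)"

definition P_class :: "plane set \<Rightarrow> (plane \<Rightarrow> real) set" where
  "P_class \<Delta> = {\<Psi>. convex_on UNIV \<Psi> \<and>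
     bdd_above (range (\<lambda>n. \<bar>\<Psi> n - (SUP m \<in> \<Delta> \<inter> lat_M. m \<bullet> n)\<bar>))}"

definition beta :: "plane set \<Rightarrow> plane set \<Rightarrow> plane \<Rightarrow> real" where
  "beta \<Delta> \<sigma> n = lattice_gen (perp_lattice lat_M (prim_normal lat_N \<Delta> \<sigma>)) \<bullet> n"

definition subgradient :: "real set \<Rightarrow> (real \<Rightarrow> real) \<Rightarrow> real \<Rightarrow> real set" where
  "subgradient I f s = {p. \<forall>t\<in>I. f t \<ge> f s + p * (t - s)}"

text \<open>The equation that the Monge--Ampere measure of the restriction of the function to the
  union of the relative interiors of the facets of the dual body equals the given measure.\<close>

definition MA_equation ::
  "plane set \<Rightarrow> (plane \<Rightarrow> int) \<Rightarrow> (plane \<Rightarrow> real) \<Rightarrow> plane measure \<Rightarrow> bool" where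
  "MA_equation \<Delta> h \<Psi> \<nu> \<longleftrightarrow>
     (\<forall>\<tau> \<sigma> E. \<tau> facet_of dual_body \<Delta> h \<longrightarrow> \<sigma> facet_of \<Delta> \<longrightarrow>
        prim_normal lat_M (dual_body \<Delta> h) \<tau> \<in> \<sigma> \<longrightarrow>
        E \<in> sets \<nu> \<longrightarrow> E \<subseteq> rel_interior \<tau> \<longrightarrow>
        emeasure lebesgue
          (\<Union>s \<in> beta \<Delta> \<sigma> ` E.
             subgradient (beta \<Delta> \<sigma> ` rel_interior \<tau>)
               (\<Psi> \<circ> inv_into (rel_interior \<tau>) (beta \<Delta> \<sigma>)) s)
        = emeasure \<nu> E)"

end

theory Submission
  imports Defs
begin

text \<open>
  The edge \<open>x = -1\<close> of the dual body carries more mass than the gradient of \<open>\<Psi>\<close> has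
  room for.  The ten inequalities for the dual body leave the pentagon with vertices (-1,0),
  (0,-1), (1,1), (1,5), (-1,4).  Its two vertical edges have lattice length 4 and the three
  others lattice length 1, so that the total is 11, whereas the boundary of \<open>\<Delta>\<close> has
  lattice length 9.  The normalising constant is therefore 9/11, and the open left edge has
  mass \<open>4 * 9/11 = 36/11 > 3\<close>.

  On the other hand, the outward normal (-1,0) of this edge lies on the facet \<open>x = -1\<close> of
  \<open>\<Delta>\<close>, whose coordinate \<open>\<beta>\<close> is \<open>y\<close> up to sign.  Since \<open>\<Psi>\<close> stays at bounded
  distance from the support function of \<open>\<Delta>\<close>, the convex function \<open>y \<mapsto> \<Psi>(-1, y)\<close> on the whole
  line can only have slopes between -1 and 2, the range of the second coordinate on
  \<open>\<Delta>\<close>.  All subgradients along the edge thus lie in an interval of length 3, the lattice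
  length of the facet \<open>x = -1\<close> of \<open>\<Delta>\<close>, which is too short.

  The slope bound is in \<open>subgradient_subset_growth\<close> and \<open>subgradient_left_edge\<close>.  The rest
  computes masses.  The choices hidden in \<open>prim_normal\<close> and \<open>lattice_gen\<close> are
  resolved once and for all for polygons given by half-planes with coprime integral normals
  (\<open>prim_normal_edge\<close>, \<open>lattice_gen_edge\<close>), and the total mass becomes a finite sum over
  the half-planes (\<open>emeasure_boundary_total\<close>).
\<close>

section \<open>Lattice vectors in the plane\<close>

lemma mem_lat_M: "x \<in> lat_M \<longleftrightarrow> (\<exists>a b. x = (of_int a, of_int b))"
  by (auto simp: lat_M_def e0_def e1_def)

lemma mem_lat_M_iff_Ints: "x \<in> lat_M \<longleftrightarrow> fst x \<in> \<int> \<and> snd x \<in> \<int>"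
  by (cases x) (auto simp: mem_lat_M elim!: Ints_cases)

lemma lat_N_eq_lat_M: "lat_N = lat_M"
proof (intro set_eqI iffI)
  fix n :: plane
  assume "n \<in> lat_N"
  then have *: "\<And>m. m \<in> lat_M \<Longrightarrow> m \<bullet> n \<in> \<int>" by (auto simp: lat_N_def)
  have "(1, 0) \<in> lat_M" "(0, 1) \<in> lat_M"
    by (simp_all add: mem_lat_M_iff_Ints)
  from this[THEN *] show "n \<in> lat_M"
    by (cases n) (auto simp: mem_lat_M_iff_Ints)
next
  fix n :: plane
  assume "n \<in> lat_M"
  then show "n \<in> lat_N" by (auto simp: lat_N_def mem_lat_M)
qed

text \<open>The quarter turn takes an outward normal to the counterclockwise direction along the edge.\<close>

definition rot :: "plane \<Rightarrow> plane" where
  "rot v = (- snd v, fst v)"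

lemma inner_rot_self: "v \<bullet> rot v = 0" "rot v \<bullet> v = 0"
  by (cases v; simp add: rot_def)+

lemma rot_eq_0_iff: "rot v = 0 \<longleftrightarrow> v = 0"
  by (auto simp: rot_def prod_eq_iff)

definition coprime_vec :: "plane \<Rightarrow> bool" where
  "coprime_vec v \<longleftrightarrow> (\<exists>a b. coprime a b \<and> v = (of_int a, of_int b))"

lemma coprime_vec_nonzero: "coprime_vec v \<Longrightarrow> v \<noteq> 0"
  by (auto simp: coprime_vec_def prod_eq_iff)

lemma coprime_vec_rot: "coprime_vec v \<Longrightarrow> coprime_vec (rot v)"
  unfolding coprime_vec_def
proof (elim exE conjE)
  fix a b :: int
  assume "coprime a b" "v = (of_int a, of_int b)"
  then show "\<exists>a b. coprime a b \<and> rot v = (of_int a, of_int b)"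
    by (intro exI[of _ "-b"] exI[of _ a]) (auto simp: rot_def coprime_commute)
qed

lemma coprime_vec_primitive:
  assumes "coprime_vec v"
  shows "primitive_in lat_M v"
proof -
  obtain a b where ab: "coprime a b" "v = (of_int a, of_int b)"
    using assms by (auto simp: coprime_vec_def)
  have "\<bar>k\<bar> = 1" if w: "w \<in> lat_M" and k: "v = of_int k *\<^sub>R w" for w and k :: int
  proof -
    obtain c d where "w = (of_int c, of_int d)" using w by (auto simp: mem_lat_M)
    with k ab have "real_of_int a = of_int (k * c)" "real_of_int b = of_int (k * d)" by auto
    then have "a = k * c" "b = k * d" by (simp_all only: of_int_eq_iff)
    then have "k dvd a" "k dvd b" by auto
    with ab(1) have "is_unit k" by (meson coprime_common_divisor)
    then show ?thesis by simp
  qed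
  then show ?thesis using ab by (auto simp: primitive_in_def mem_lat_M)
qed

text \<open>If \<open>c a + d b = 0\<close> with \<open>a\<close> and \<open>b\<close> coprime, then \<open>a\<close> divides \<open>d\<close>, and the quotient
  is the required multiple.\<close>

lemma perp_lattice_coprime:
  assumes "coprime_vec v"
  shows "perp_lattice lat_M v = range (\<lambda>k::int. of_int k *\<^sub>R rot v)"
proof -
  obtain a b where ab: "coprime a b" "v = (of_int a, of_int b)"
    using assms by (auto simp: coprime_vec_def)
  have "\<exists>k::int. w = of_int k *\<^sub>R rot v" if w: "w \<in> lat_M" "w \<bullet> v = 0" for w
  proof -
    obtain c d where cd: "w = (of_int c, of_int d)" using w by (auto simp: mem_lat_M)
    with w ab have "real_of_int (c * a + d * b) = 0" by simp
    then have eq: "c * a = - d * b" by linarith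
    show ?thesis
    proof (cases "a = 0")
      \<comment> \<open>Here one cannot divide by \<open>a\<close>, but coprimality makes \<open>b\<close> a unit.\<close>
      case True
      then have "\<bar>b\<bar> = 1" using ab by simp
      then have "b = 1 \<or> b = -1" by linarith
      moreover from this have "d = 0" using eq True by auto
      ultimately show ?thesis using cd ab True
        by (intro exI[of _ "- c * b"]) (auto simp: rot_def)
    next
      case False
      have "a dvd d * b" using eq by (metis dvd_minus_iff dvd_triv_right mult_minus_left)
      with ab(1) have "a dvd d" using coprime_dvd_mult_left_iff by blast
      then obtain k where k: "d = a * k" by (auto elim: dvdE)
      with eq have "a * c = a * (- k * b)" by (simp add: algebra_simps)
      with False have "c = - k * b" by (metis mult_cancel_left)
      then show ?thesis using cd ab k by (intro exI[of _ k]) (auto simp: rot_def)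
    qed
  qed
  moreover have "of_int k *\<^sub>R rot v \<in> perp_lattice lat_M v" for k :: int
  proof -
    have "of_int k *\<^sub>R rot v = (of_int (k * - b), of_int (k * a))" using ab by (simp add: rot_def)
    then have "of_int k *\<^sub>R rot v \<in> lat_M" unfolding mem_lat_M by blast
    then show ?thesis by (simp add: perp_lattice_def inner_rot_self)
  qed
  ultimately show ?thesis unfolding perp_lattice_def by blast
qed

text \<open>Two generators are integral multiples of each other, so the two factors are inverse
  units.\<close>

lemma lattice_gen_cases:
  assumes "g \<noteq> 0"
  shows "lattice_gen (range (\<lambda>k::int. of_int k *\<^sub>R g)) \<in> {g, - g}"
proof -
  let ?G = "range (\<lambda>k::int. of_int k *\<^sub>R g)"
  define g' where "g' = lattice_gen ?G"
  have G: "?G = range (\<lambda>k::int. of_int k *\<^sub>R g')"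
    unfolding g'_def lattice_gen_def by (rule someI[of _ g]) simp
  have "g \<in> ?G" by (rule range_eqI[of _ _ 1]) simp
  then obtain k :: int where k: "g = of_int k *\<^sub>R g'" unfolding G by auto
  have "g' \<in> ?G" unfolding G by (rule range_eqI[of _ _ 1]) simp
  then obtain l :: int where l: "g' = of_int l *\<^sub>R g" by auto
  from k l have "g = of_int (k * l) *\<^sub>R g" by simp
  then have "(of_int (k * l) - 1) *\<^sub>R g = 0" by (simp add: scaleR_diff_left)
  with assms have "real_of_int (k * l) = 1" by simp
  then have "k * l = 1" by (simp only: of_int_eq_1_iff)
  then have "l = 1 \<or> l = -1" by (metis mult.commute zmult_eq_1_iff)
  with l show ?thesis unfolding g'_def by auto
qed

section \<open>Facets of a polygon cut out by half-planes\<close>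

definition polygon :: "(plane \<times> real) set \<Rightarrow> plane set" where
  "polygon H = {x. \<forall>(v, b)\<in>H. v \<bullet> x \<le> b}"

definition edge :: "(plane \<times> real) set \<Rightarrow> plane \<times> real \<Rightarrow> plane set" where
  "edge H h = {x \<in> polygon H. fst h \<bullet> x = snd h}"

text \<open>The point violating only the inequality \<open>(v, b)\<close> certifies that this half-plane cannot be
  dropped; the strictly feasible point makes the polygon two-dimensional.\<close>

definition irredundant :: "(plane \<times> real) set \<Rightarrow> bool" where
  "irredundant H \<longleftrightarrow> finite H \<and> (\<exists>x. \<forall>(v, b)\<in>H. v \<bullet> x < b) \<and>
     (\<forall>(v, b)\<in>H. \<exists>x. v \<bullet> x > b \<and> (\<forall>(v', b')\<in>H - {(v, b)}. v' \<bullet> x \<le> b'))"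

text \<open>The facets of an irredundant intersection of half-spaces are known
  (\<open>facet_of_polyhedron_explicit\<close>), with the half-spaces as an index set.  To index by
  inequalities, the witnesses are used a second time: they show that different inequalities cut
  out different half-planes.\<close>

lemma polyhedron_polygon:
  assumes "irredundant H"
  shows "polyhedron (polygon H)"
    and "\<And>F. F facet_of polygon H \<longleftrightarrow> (\<exists>h\<in>H. F = edge H h)"
proof -
  have fin: "finite H" using assms by (simp add: irredundant_def)
  obtain z where z: "\<And>v b. (v, b) \<in> H \<Longrightarrow> v \<bullet> z < b"
    using assms unfolding irredundant_def by blast
  have wit: "\<exists>x. v \<bullet> x > b \<and> (\<forall>(v', b')\<in>H - {(v, b)}. v' \<bullet> x \<le> b')" if "(v, b) \<in> H" for v b
    using assms that unfolding irredundant_def by blast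
  have nz: "v \<noteq> 0" if "(v, b) \<in> H" for v b
    using z[OF that] wit[OF that] by auto
  define hp :: "plane \<times> real \<Rightarrow> plane set" where "hp = (\<lambda>(v, b). {x. v \<bullet> x \<le> b})"
  have inj: "inj_on hp H"
  proof (rule inj_onI)
    fix h h' assume h: "h \<in> H" "h' \<in> H" "hp h = hp h'"
    obtain v b where hv: "h = (v, b)" by fastforce
    obtain x where "v \<bullet> x > b" "\<forall>(v', b')\<in>H - {(v, b)}. v' \<bullet> x \<le> b'"
      using wit h hv by blast
    then have "x \<notin> hp h" "h' \<noteq> h \<Longrightarrow> x \<in> hp h'" using h hv by (fastforce simp: hp_def)+
    with h show "h = h'" by auto
  qed
  let ?n = "\<lambda>S. fst (inv_into H hp S)" and ?b = "\<lambda>S. snd (inv_into H hp S)"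
  have P: "polygon H = \<Inter>(hp ` H)" by (auto simp: polygon_def hp_def)
  show ph: "polyhedron (polygon H)"
    unfolding P using fin by (intro polyhedron_Inter) (auto simp: hp_def polyhedron_halfspace_le)
  have "open (\<Inter>h\<in>H. {x. fst h \<bullet> x < snd h})" (is "open ?U")
    using fin by (intro open_INT) (auto intro: open_halfspace_lt)
  moreover have "?U \<subseteq> polygon H" by (fastforce simp: polygon_def)
  ultimately have "?U \<subseteq> interior (polygon H)" by (intro interior_maximal)
  moreover have "z \<in> ?U" using z by auto
  ultimately have "interior (polygon H) \<noteq> {}" by blast
  then have aff: "affine hull polygon H = UNIV" by (rule affine_hull_nonempty_interior)
  show "F facet_of polygon H \<longleftrightarrow> (\<exists>h\<in>H. F = edge H h)" for F
  proof -
    have "F facet_of polygon H \<longleftrightarrow>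
      (\<exists>S. S \<in> hp ` H \<and> F = polygon H \<inter> {x. ?n S \<bullet> x = ?b S})"
    proof (rule facet_of_polyhedron_explicit)
      show "finite (hp ` H)" using fin by simp
      show "polygon H = affine hull polygon H \<inter> \<Inter>(hp ` H)" using aff P by simp
      show "?n S \<noteq> 0 \<and> S = {x. ?n S \<bullet> x \<le> ?b S}" if "S \<in> hp ` H" for S
      proof -
        obtain v b where vb: "(v, b) \<in> H" "S = hp (v, b)" using \<open>S \<in> hp ` H\<close> by auto
        then have "inv_into H hp S = (v, b)" using inj by simp
        then show ?thesis using vb nz by (simp add: hp_def)
      qed
      show "polygon H \<subset> affine hull polygon H \<inter> \<Inter>\<H>" if sub: "\<H> \<subset> hp ` H" for \<H>
      proof -
        obtain v b where h: "(v, b) \<in> H" "hp (v, b) \<notin> \<H>" using sub by auto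
        obtain x where x: "v \<bullet> x > b" "\<forall>(v', b')\<in>H - {(v, b)}. v' \<bullet> x \<le> b'"
          using wit h by blast
        have "x \<in> \<Inter>\<H>"
        proof
          fix S assume S: "S \<in> \<H>"
          then obtain h' where "h' \<in> H" "S = hp h'" using sub by blast
          moreover from this have "h' \<noteq> (v, b)" using h S by blast
          ultimately show "x \<in> S" using x by (auto simp: hp_def)
        qed
        moreover have "x \<notin> polygon H" using h x by (fastforce simp: polygon_def)
        moreover have "polygon H \<subseteq> \<Inter>\<H>" using sub P by auto
        ultimately show ?thesis using aff by auto
      qed
    qed
    also have "\<dots> \<longleftrightarrow> (\<exists>h\<in>H. F = edge H h)"
      using inj by (auto simp: edge_def)
    finally show ?thesis .
  qed
qed

text \<open>For a coprime integral normal \<open>v\<close>, the vector \<open>rot v\<close> generates the lattice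
  along the edge.  So \<open>l\<close> is the lattice length of the edge that starts at \<open>p\<close> and runs
  counterclockwise.\<close>

definition lattice_edge :: "(plane \<times> real) set \<Rightarrow> plane \<times> real \<Rightarrow> plane \<Rightarrow> real \<Rightarrow> bool" where
  "lattice_edge H h p l \<longleftrightarrow> h \<in> H \<and> coprime_vec (fst h) \<and> l > 0 \<and>
     edge H h = (\<lambda>u. p + u *\<^sub>R rot (fst h)) ` {0..l}"

text \<open>Any primitive normal is constant along the edge, hence an integral multiple of
  \<open>v\<close>, hence \<open>v\<close> or \<open>- v\<close>; an interior point of the polygon rules out the inward normal.\<close>

lemma prim_normal_edge:
  assumes H: "irredundant H" and e: "lattice_edge H h p l"
  shows "prim_normal lat_M (polygon H) (edge H h) = fst h"
  unfolding prim_normal_def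
proof (rule the_equality)
  obtain v b where h: "h = (v, b)" by fastforce
  have hH: "(v, b) \<in> H" and cop: "coprime_vec v" and l: "l > 0"
    and seg: "edge H h = (\<lambda>u. p + u *\<^sub>R rot v) ` {0..l}"
    using e h by (auto simp: lattice_edge_def)
  show "primitive_in lat_M (fst h) \<and> outward_normal (polygon H) (edge H h) (fst h)"
    using coprime_vec_primitive[OF cop] hH h
    by (auto simp: outward_normal_def edge_def polygon_def intro!: exI[of _ b])
  fix w
  assume w: "primitive_in lat_M w \<and> outward_normal (polygon H) (edge H h) w"
  then obtain a where a: "\<And>x. x \<in> polygon H \<Longrightarrow> w \<bullet> x \<le> a"
    "edge H h = {x \<in> polygon H. w \<bullet> x = a}"
    by (auto simp: outward_normal_def)
  have "p + 0 *\<^sub>R rot v \<in> edge H h" "p + l *\<^sub>R rot v \<in> edge H h"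
    unfolding seg using l by (auto intro!: imageI simp del: scaleR_zero_left)
  then have pe: "p \<in> polygon H" "w \<bullet> p = a" "w \<bullet> (p + l *\<^sub>R rot v) = a" "v \<bullet> p = b"
    using a(2) h by (auto simp: edge_def)
  then have "w \<bullet> rot v = 0" using l by (simp add: inner_add_right)
  then have "w \<in> perp_lattice lat_M (rot v)"
    using w by (auto simp: perp_lattice_def primitive_in_def)
  then obtain k :: int where k: "w = of_int k *\<^sub>R rot (rot v)"
    using perp_lattice_coprime[OF coprime_vec_rot[OF cop]] by auto
  have rr: "rot (rot v) = - v" by (cases v) (simp add: rot_def)
  have "rot (rot v) \<in> lat_M"
    using coprime_vec_primitive[OF coprime_vec_rot[OF coprime_vec_rot[OF cop]]]
    by (simp add: primitive_in_def)
  with k w have "\<bar>k\<bar> = 1" by (auto simp: primitive_in_def)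
  then have "w = v \<or> w = - v" using k rr by (cases "k \<ge> 0") auto
  moreover have "w \<noteq> - v"
  proof
    assume wv: "w = - v"
    obtain z where z: "\<And>v b. (v, b) \<in> H \<Longrightarrow> v \<bullet> z < b"
      using H unfolding irredundant_def by blast
    then have "z \<in> polygon H" by (auto simp: polygon_def less_imp_le)
    from a(1)[OF this] z[OF hH] pe show False by (simp add: wv)
  qed
  ultimately show "w = fst h" using h by simp
qed

lemma lattice_gen_edge:
  assumes "irredundant H" "lattice_edge H h p l"
  shows "lattice_gen (perp_lattice lat_M (prim_normal lat_M (polygon H) (edge H h)))
    \<in> {rot (fst h), - rot (fst h)}"
proof -
  have "coprime_vec (fst h)" using assms(2) by (simp add: lattice_edge_def)
  then show ?thesis
    unfolding prim_normal_edge[OF assms] perp_lattice_coprime[OF \<open>coprime_vec (fst h)\<close>]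
    by (intro lattice_gen_cases) (simp add: rot_eq_0_iff coprime_vec_nonzero)
qed

section \<open>The lattice length measure on the boundary\<close>

lemma borel_segment:
  fixes p g :: plane
  assumes "I \<in> {{0..l}, {0<..<l}}"
  shows "(\<lambda>u. p + u *\<^sub>R g) ` I \<in> sets borel"
proof (cases "g = 0")
  case False
  have "(\<lambda>u. p + u *\<^sub>R g) ` {0..l} \<in> sets borel"
    by (intro borel_compact compact_continuous_image continuous_intros) auto
  moreover have "(\<lambda>u. p + u *\<^sub>R g) ` {0<..<l} =
      (\<lambda>u. p + u *\<^sub>R g) ` {0..l} - {p, p + l *\<^sub>R g}"
    using False by (auto simp: less_le)
  ultimately show ?thesis using assms by auto
qed (auto simp: image_constant_conv)

text \<open>Neither the base point chosen in \<open>F\<close> nor the sign of the generator matters: the preimage of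
  the segment under the parametrization is an interval of length \<open>l\<close> in each case.\<close>

lemma emeasure_lattice_length_segment:
  assumes gen: "lattice_gen G \<in> {g, - g}" and g: "g \<noteq> 0" and l: "0 \<le> l"
    and F: "F = (\<lambda>u. p + u *\<^sub>R g) ` {0..l}"
    and I: "I \<in> {{0..l}, {0<..<l}}"
  shows "emeasure (lattice_length G F) ((\<lambda>u. p + u *\<^sub>R g) ` I) = ennreal l"
proof -
  define x where "x = (SOME x. x \<in> F)"
  have "x \<in> F" unfolding x_def by (rule someI[of _ p]) (use F l in force)
  then obtain s where s: "x = p + s *\<^sub>R g" using F by auto
  have inj: "p + u *\<^sub>R g = p + u' *\<^sub>R g \<longleftrightarrow> u = u'" for u u' using g by auto
  have "(\<lambda>u. p + u *\<^sub>R g) ` I \<in> sets borel" using borel_segment I by blast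
  then have "emeasure (lattice_length G F) ((\<lambda>u. p + u *\<^sub>R g) ` I) =
      emeasure lborel ((\<lambda>t. x + t *\<^sub>R lattice_gen G) -` ((\<lambda>u. p + u *\<^sub>R g) ` I))"
    unfolding lattice_length_def x_def[symmetric] by (subst emeasure_distr) auto
  also have "\<dots> = ennreal l"
  proof (cases "lattice_gen G = g")
    case True
    have "x + t *\<^sub>R g = p + (s + t) *\<^sub>R g" for t using s by (simp add: scaleR_add_left)
    then have "(\<lambda>t. x + t *\<^sub>R g) -` ((\<lambda>u. p + u *\<^sub>R g) ` I) = {t. s + t \<in> I}"
      using inj by auto
    also have "\<dots> \<in> {{- s..l - s}, {- s<..<l - s}}" using I by auto
    finally show ?thesis using l True by auto
  next
    case False
    with gen have gm: "lattice_gen G = - g" by auto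
    have "x + t *\<^sub>R (- g) = p + (s - t) *\<^sub>R g" for t
      using s by (simp add: scaleR_diff_left)
    then have "(\<lambda>t. x + t *\<^sub>R (- g)) -` ((\<lambda>u. p + u *\<^sub>R g) ` I) = {t. s - t \<in> I}"
      using inj by auto
    also have "\<dots> \<in> {{s - l..s}, {s - l<..<s}}" using I by auto
    finally show ?thesis using l gm by auto
  qed
  finally show ?thesis .
qed

text \<open>A measure defined by \<open>measure_of\<close> takes the prescribed values only if these are countably
  additive.  They are, since each summand is a measure restricted to a closed set.\<close>

lemma emeasure_boundary_measure:
  assumes P: "polyhedron P" and X: "X \<in> sets borel" "X \<subseteq> frontier P"
  shows "emeasure (boundary_measure L K P) X =
    (\<Sum>F | F facet_of P. emeasure (lattice_length (perp_lattice L (prim_normal K P F)) F) (X \<inter> F))"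
  unfolding boundary_measure_def
proof (rule emeasure_measure_of_sigma)
  let ?A = "sets (restrict_space borel (frontier P))"
  let ?M = "\<lambda>F. lattice_length (perp_lattice L (prim_normal K P F)) F"
  have sets: "X \<in> ?A \<longleftrightarrow> X \<in> sets borel \<and> X \<subseteq> frontier P" for X
    by (subst sets_restrict_space_iff) auto
  show "sigma_algebra (frontier P) ?A"
    using sets.sigma_algebra_axioms[of "restrict_space borel (frontier P)"]
    by (simp add: space_restrict_space)
  show "X \<in> ?A" using X sets by simp
  show "positive ?A (\<lambda>E. \<Sum>F | F facet_of P. emeasure (?M F) (E \<inter> F))"
    by (simp add: positive_def)
  have Fb: "F \<in> sets borel" if "F facet_of P" for F
    using that P by (meson borel_closed facet_of_imp_face_of face_of_imp_closed
        polyhedron_imp_closed polyhedron_imp_convex)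
  show "countably_additive ?A (\<lambda>E. \<Sum>F | F facet_of P. emeasure (?M F) (E \<inter> F))"
    unfolding countably_additive_def
  proof (intro allI impI)
    fix A :: "nat \<Rightarrow> plane set"
    assume A: "range A \<subseteq> ?A" "disjoint_family A" "\<Union> (range A) \<in> ?A"
    have Ab: "A i \<in> sets borel" for i using A(1) sets by auto
    have "(\<Sum>i. \<Sum>F | F facet_of P. emeasure (?M F) (A i \<inter> F)) =
        (\<Sum>F | F facet_of P. \<Sum>i. emeasure (?M F) (A i \<inter> F))"
      by (rule suminf_sum) auto
    also have "\<dots> = (\<Sum>F | F facet_of P. emeasure (?M F) (\<Union> (range A) \<inter> F))"
    proof (rule sum.cong[OF refl])
      fix F assume "F \<in> {F. F facet_of P}"
      then have "range (\<lambda>i. A i \<inter> F) \<subseteq> sets (?M F)"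
        using Ab Fb by (auto simp: lattice_length_def)
      moreover have "disjoint_family (\<lambda>i. A i \<inter> F)"
        using A(2) by (auto simp: disjoint_family_on_def)
      ultimately show "(\<Sum>i. emeasure (?M F) (A i \<inter> F)) = emeasure (?M F) (\<Union> (range A) \<inter> F)"
        by (simp add: suminf_emeasure)
    qed
    finally show "(\<Sum>i. \<Sum>F | F facet_of P. emeasure (?M F) (A i \<inter> F)) =
      (\<Sum>F | F facet_of P. emeasure (?M F) (\<Union> (range A) \<inter> F))" .
  qed
qed

lemma sets_boundary_measure:
  "X \<in> sets (boundary_measure L K P) \<longleftrightarrow> X \<in> sets borel \<and> X \<subseteq> frontier P"
proof -
  have "sets (boundary_measure L K P) = sets (restrict_space borel (frontier P))"
    unfolding boundary_measure_def
    using sets.sigma_sets_eq[of "restrict_space borel (frontier P)"]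
      sets.space_closed[of "restrict_space borel (frontier P)"]
    by (simp add: space_restrict_space)
  then show ?thesis by (auto simp: sets_restrict_space_iff)
qed

lemma facet_subset_frontier:
  assumes "polyhedron P" "F facet_of P"
  shows "F \<subseteq> frontier P"
proof -
  have "F face_of P" "F \<noteq> P"
    using assms(2) facet_of_imp_face_of facet_of_irrefl by blast+
  then have "F \<subseteq> rel_frontier P"
    using assms(1) by (simp add: face_of_subset_rel_frontier polyhedron_imp_convex)
  moreover have "rel_frontier P \<subseteq> frontier P"
    using interior_subset_rel_interior by (auto simp: rel_frontier_def frontier_def)
  ultimately show ?thesis by blast
qed

text \<open>Distinct inequalities give distinct edges, because the normal and then the right hand side
  can be recovered from the edge; so each half-plane contributes exactly once.\<close>

lemma emeasure_boundary_total:
  assumes H: "irredundant H" and e: "\<And>h. h \<in> H \<Longrightarrow> lattice_edge H h (p h) (l h)"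
  shows "emeasure (boundary_measure lat_M lat_M (polygon H)) (frontier (polygon H)) =
    (\<Sum>h\<in>H. ennreal (l h))"
proof -
  let ?P = "polygon H"
  let ?M = "\<lambda>F. lattice_length (perp_lattice lat_M (prim_normal lat_M ?P F)) F"
  have ph: "polyhedron ?P" and facets: "{F. F facet_of ?P} = edge H ` H"
    using polyhedron_polygon[OF H] by auto
  have inj: "inj_on (edge H) H"
  proof (rule inj_onI)
    fix h h' assume hh: "h \<in> H" "h' \<in> H" "edge H h = edge H h'"
    have fst: "fst h = fst h'"
      using prim_normal_edge[OF H e[OF hh(1)]] prim_normal_edge[OF H e[OF hh(2)]] hh(3) by simp
    have "p h + 0 *\<^sub>R rot (fst h) \<in> edge H h"
      using e[OF hh(1)] unfolding lattice_edge_def by force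
    then have "fst h \<bullet> p h = snd h" "fst h' \<bullet> p h = snd h'"
      using hh(3) by (auto simp: edge_def)
    with fst show "h = h'" by (metis prod_eqI)
  qed
  have "emeasure (boundary_measure lat_M lat_M ?P) (frontier ?P) =
      (\<Sum>F | F facet_of ?P. emeasure (?M F) (frontier ?P \<inter> F))"
    by (rule emeasure_boundary_measure[OF ph]) auto
  also have "\<dots> = (\<Sum>F | F facet_of ?P. emeasure (?M F) F)"
    by (rule sum.cong) (auto dest: facet_subset_frontier[OF ph] simp: Int_absorb1)
  also have "\<dots> = (\<Sum>h\<in>H. emeasure (?M (edge H h)) (edge H h))"
    unfolding facets by (simp add: sum.reindex[OF inj])
  also have "\<dots> = (\<Sum>h\<in>H. ennreal (l h))"
  proof (rule sum.cong[OF refl])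
    fix h assume "h \<in> H"
    note eh = e[OF this]
    then have seg: "edge H h = (\<lambda>u. p h + u *\<^sub>R rot (fst h)) ` {0..l h}"
      and "l h > 0" "rot (fst h) \<noteq> 0"
      using coprime_vec_nonzero rot_eq_0_iff by (auto simp: lattice_edge_def)
    then show "emeasure (?M (edge H h)) (edge H h) = ennreal (l h)"
      using emeasure_lattice_length_segment[OF lattice_gen_edge[OF H eh] _ _ seg, of "{0..l h}"]
      by (simp add: seg)
  qed
  finally show ?thesis .
qed

section \<open>Slopes of convex functions\<close>

text \<open>By convexity a supporting line of \<open>\<phi>\<close> over a neighbourhood of \<open>s\<close> supports \<open>\<phi>\<close> on
  the whole line.  If its slope left the interval from \<open>a\<close> to \<open>b\<close>, it would overtake the growth
  bound far out to the left or to the right.  The function \<open>f\<close> agrees with \<open>\<phi>\<close> only on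
  \<open>I\<close>, as it arises from an inverse that has arbitrary values elsewhere.\<close>

lemma subgradient_subset_growth:
  assumes ab: "a \<le> b" and conv: "convex_on UNIV \<phi>" and I: "open I" "s \<in> I"
    and f: "\<And>t. t \<in> I \<Longrightarrow> f t = \<phi> t"
    and growth: "\<And>t. \<phi> t \<le> C + max (a * t) (b * t)"
  shows "subgradient I f s \<subseteq> {a..b}"
proof
  fix q assume "q \<in> subgradient I f s"
  then have q: "\<phi> t \<ge> \<phi> s + q * (t - s)" if "t \<in> I" for t
    using that f I(2) by (auto simp: subgradient_def)
  obtain e where e: "e > 0" "ball s e \<subseteq> I" using I openE by blast
  have glob: "\<phi> t \<ge> \<phi> s + q * (t - s)" for t
  proof (cases "t = s")
    case False
    \<comment> \<open>The factor \<open>r\<close> moves \<open>t\<close> towards \<open>s\<close> until it lies in the ball.\<close>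
    define r where "r = min 1 (e / (2 * \<bar>t - s\<bar>))"
    have r: "0 < r" "r \<le> 1" using False e by (auto simp: r_def)
    have "r * \<bar>t - s\<bar> \<le> e / (2 * \<bar>t - s\<bar>) * \<bar>t - s\<bar>"
      by (intro mult_right_mono) (auto simp: r_def)
    also have "\<dots> < e" using False e by simp
    finally have "dist s (s + r * (t - s)) < e" using r by (simp add: dist_real_def abs_mult)
    then have "s + r * (t - s) \<in> I" using e by auto
    from q[OF this] have "\<phi> s + q * (r * (t - s)) \<le> \<phi> (s + r * (t - s))" by simp
    also have "s + r * (t - s) = (1 - r) *\<^sub>R s + r *\<^sub>R t" by (simp add: algebra_simps)
    also have "\<phi> \<dots> \<le> (1 - r) * \<phi> s + r * \<phi> t"
      using convex_onD[OF conv, of r s t] r by simp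
    finally have "r * (\<phi> s + q * (t - s)) \<le> r * \<phi> t" by (simp add: algebra_simps)
    with r show ?thesis by simp
  qed simp
  define D where "D = \<bar>C - \<phi> s + q * s\<bar>"
  have D: "q * t \<le> D + max (a * t) (b * t)" for t
    using glob[of t] growth[of t] unfolding D_def by (simp add: algebra_simps)
  show "q \<in> {a..b}"
  proof (rule ccontr)
    assume "q \<notin> {a..b}"
    then consider "q < a" | "q > b" by fastforce
    then show False
    proof cases
      case 1
      define t where "t = - (D + 1) / (a - q)"
      have "t \<le> 0" using 1 unfolding t_def by (intro divide_nonpos_pos) (auto simp: D_def)
      then have "max (a * t) (b * t) = a * t" using ab by (simp add: mult_right_mono_neg)
      moreover have "(a - q) * t = - (D + 1)" using 1 by (simp add: t_def)
      ultimately show False using D[of t] by (simp add: algebra_simps)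
    next
      case 2
      define t where "t = (D + 1) / (q - b)"
      have "t \<ge> 0" using 2 by (simp add: t_def D_def)
      then have "max (a * t) (b * t) = b * t" using ab by (simp add: mult_right_mono)
      moreover have "(q - b) * t = D + 1" using 2 by (simp add: t_def)
      ultimately show False using D[of t] by (simp add: algebra_simps)
    qed
  qed
qed

text \<open>A pointwise bound on the support function bounds every member of the class up to a
  constant; only points of \<open>S\<close> matter, so that \<open>B\<close> can be adapted to a line.\<close>

lemma P_class_growth:
  assumes "\<Psi> \<in> P_class \<Delta>" and ne: "\<Delta> \<inter> lat_M \<noteq> {}"
    and B: "\<And>m n. m \<in> \<Delta> \<inter> lat_M \<Longrightarrow> n \<in> S \<Longrightarrow> m \<bullet> n \<le> B n"
  shows "\<exists>C. \<forall>n\<in>S. \<Psi> n \<le> C + B n"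
proof -
  obtain C where C: "\<And>n. \<bar>\<Psi> n - (SUP m \<in> \<Delta> \<inter> lat_M. m \<bullet> n)\<bar> \<le> C"
    using assms(1) unfolding P_class_def bdd_above_def by auto
  have "\<Psi> n \<le> C + B n" if "n \<in> S" for n
  proof -
    have "(SUP m \<in> \<Delta> \<inter> lat_M. m \<bullet> n) \<le> B n"
      using ne B that by (intro cSUP_least) auto
    with C[of n] show ?thesis by linarith
  qed
  then show ?thesis by blast
qed

section \<open>The two polygons\<close>

definition moment_triangle :: "(plane \<times> real) set" where
  "moment_triangle = {((-1, 0), 1), ((0, -1), 1), ((1, 1), 1)}"

definition dual_pentagon :: "(plane \<times> real) set" where
  "dual_pentagon =
    {((1, 0), 1), ((-1, 2), 9), ((-1, 0), 1), ((-1, -1), 1), ((2, -1), 1)}"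

text \<open>In the nontrivial inclusion the barycentric coordinates of a point are the slacks of the three
  inequalities, divided by 3.\<close>

lemma moment_triangle_eq_hull:
  "convex hull {- e0 + 2 *\<^sub>R e1, 2 *\<^sub>R e0 - e1, - e0 - e1} = polygon moment_triangle"
  (is "?L = ?R")
proof
  have "convex ?R"
    by (rule convexI) (auto simp: polygon_def moment_triangle_def algebra_simps
        intro: convex_bound_le)
  then show "?L \<subseteq> ?R"
    by (intro hull_minimal) (auto simp: polygon_def moment_triangle_def e0_def e1_def)
  show "?R \<subseteq> ?L"
  proof
    fix z :: plane assume z: "z \<in> ?R"
    obtain x y where xy: "z = (x, y)" by fastforce
    have "0 \<le> (y + 1) / 3" "0 \<le> (x + 1) / 3" "0 \<le> (1 - x - y) / 3"
      "(y + 1) / 3 + (x + 1) / 3 + (1 - x - y) / 3 = 1"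
      using z xy by (auto simp: polygon_def moment_triangle_def field_simps)
    moreover have "z = ((y + 1) / 3) *\<^sub>R (- e0 + 2 *\<^sub>R e1) + ((x + 1) / 3) *\<^sub>R (2 *\<^sub>R e0 - e1) +
      ((1 - x - y) / 3) *\<^sub>R (- e0 - e1)"
      by (simp add: xy e0_def e1_def field_simps)
    ultimately show "z \<in> ?L" unfolding convex_hull_3 by blast
  qed
qed

lemma irredundant_moment_triangle: "irredundant moment_triangle"
proof -
  \<comment> \<open>The origin is strictly feasible, as all right hand sides are positive.\<close>
  have "\<exists>x::plane. \<forall>(v, b)\<in>moment_triangle. v \<bullet> x < b"
    by (rule exI[of _ 0]) (auto simp: moment_triangle_def)
  moreover have "\<exists>x. v \<bullet> x > b \<and> (\<forall>(v', b')\<in>moment_triangle - {(v, b)}. v' \<bullet> x \<le> b')"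
    if vb: "(v, b) \<in> moment_triangle" for v b
  proof -
    define x :: plane where
      "x = (if v = (-1, 0) then (-2, 0) else if v = (0, -1) then (0, -2) else (1, 1))"
    show ?thesis using vb by (intro exI[of _ x]) (auto simp: moment_triangle_def x_def)
  qed
  moreover have "finite moment_triangle" by (simp add: moment_triangle_def)
  ultimately show ?thesis unfolding irredundant_def by blast
qed

lemma irredundant_dual_pentagon: "irredundant dual_pentagon"
proof -
  have "\<exists>x::plane. \<forall>(v, b)\<in>dual_pentagon. v \<bullet> x < b"
    by (rule exI[of _ 0]) (auto simp: dual_pentagon_def)
  moreover have "\<exists>x. v \<bullet> x > b \<and> (\<forall>(v', b')\<in>dual_pentagon - {(v, b)}. v' \<bullet> x \<le> b')"
    if vb: "(v, b) \<in> dual_pentagon" for v b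
  proof -
    define x :: plane where
      "x = (if v = (-1, 0) then (-2, 3) else if v = (-1, 2) then (0, 5)
        else if v = (1, 0) then (2, 4) else if v = (-1, -1) then (-1, -1) else (1, 0))"
    show ?thesis using vb by (intro exI[of _ x]) (auto simp: dual_pentagon_def x_def)
  qed
  moreover have "finite dual_pentagon" by (simp add: dual_pentagon_def)
  ultimately show ?thesis unfolding irredundant_def by blast
qed

lemma coprime_vecI: "coprime a b \<Longrightarrow> v = (of_int a, of_int b) \<Longrightarrow> coprime_vec v"
  by (auto simp: coprime_vec_def)

text \<open>The parametrization of an edge in coordinates, in which it amounts to linear arithmetic.\<close>

lemma lattice_edgeI:
  assumes "(v, b) \<in> H" "coprime_vec v" "l > 0"
    and "\<And>x y. (x, y) \<in> edge H (v, b) \<longleftrightarrow> (\<exists>u\<in>{0..l}. x = fst p - u * snd v \<and> y = snd p + u * fst v)"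
  shows "lattice_edge H (v, b) p l"
proof -
  have "edge H (v, b) = (\<lambda>u. p + u *\<^sub>R rot v) ` {0..l}"
  proof (rule set_eqI)
    fix z :: plane
    obtain x y where "z = (x, y)" by fastforce
    then show "z \<in> edge H (v, b) \<longleftrightarrow> z \<in> (\<lambda>u. p + u *\<^sub>R rot v) ` {0..l}"
      by (simp only: assms(4) image_iff) (simp add: rot_def prod_eq_iff)
  qed
  then show ?thesis using assms by (simp add: lattice_edge_def)
qed

lemma moment_triangle_edges:
  "lattice_edge moment_triangle ((-1, 0), 1) (-1, 2) 3"
  "lattice_edge moment_triangle ((0, -1), 1) (-1, -1) 3"
  "lattice_edge moment_triangle ((1, 1), 1) (2, -1) 3"
proof -
  note defs = edge_def polygon_def moment_triangle_def
  show "lattice_edge moment_triangle ((-1, 0), 1) (-1, 2) 3"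
    by (rule lattice_edgeI, simp add: defs, rule coprime_vecI[of "-1" 0])
      (auto simp: defs intro!: bexI[of _ "2 - y" for y])
  show "lattice_edge moment_triangle ((0, -1), 1) (-1, -1) 3"
    by (rule lattice_edgeI, simp add: defs, rule coprime_vecI[of 0 "-1"])
      (auto simp: defs intro!: bexI[of _ "x + 1" for x])
  show "lattice_edge moment_triangle ((1, 1), 1) (2, -1) 3"
    by (rule lattice_edgeI, simp add: defs, rule coprime_vecI[of 1 1])
      (auto simp: defs intro!: bexI[of _ "y + 1" for y])
qed

lemma dual_pentagon_edges:
  "lattice_edge dual_pentagon ((1, 0), 1) (1, 1) 4"
  "lattice_edge dual_pentagon ((-1, 2), 9) (1, 5) 1"
  "lattice_edge dual_pentagon ((-1, 0), 1) (-1, 4) 4"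
  "lattice_edge dual_pentagon ((-1, -1), 1) (-1, 0) 1"
  "lattice_edge dual_pentagon ((2, -1), 1) (0, -1) 1"
proof -
  note defs = edge_def polygon_def dual_pentagon_def
  show "lattice_edge dual_pentagon ((1, 0), 1) (1, 1) 4"
    by (rule lattice_edgeI, simp add: defs, rule coprime_vecI[of 1 0])
      (auto simp: defs intro!: bexI[of _ "y - 1" for y])
  show "lattice_edge dual_pentagon ((-1, 2), 9) (1, 5) 1"
    by (rule lattice_edgeI, simp add: defs, rule coprime_vecI[of "-1" 2])
      (auto simp: defs intro!: bexI[of _ "5 - y" for y])
  show "lattice_edge dual_pentagon ((-1, 0), 1) (-1, 4) 4"
    by (rule lattice_edgeI, simp add: defs, rule coprime_vecI[of "-1" 0])
      (auto simp: defs intro!: bexI[of _ "4 - y" for y])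
  show "lattice_edge dual_pentagon ((-1, -1), 1) (-1, 0) 1"
    by (rule lattice_edgeI, simp add: defs, rule coprime_vecI[of "-1" "-1"])
      (auto simp: defs intro!: bexI[of _ "- y" for y])
  show "lattice_edge dual_pentagon ((2, -1), 1) (0, -1) 1"
    by (rule lattice_edgeI, simp add: defs, rule coprime_vecI[of 2 "-1"])
      (auto simp: defs intro!: bexI[of _ x for x])
qed

lemma emeasure_moment_triangle:
  "emeasure (boundary_measure lat_M lat_M (polygon moment_triangle))
    (frontier (polygon moment_triangle)) = 9"
proof -
  have "emeasure (boundary_measure lat_M lat_M (polygon moment_triangle))
      (frontier (polygon moment_triangle)) = (\<Sum>h\<in>moment_triangle. ennreal 3)"
  proof (rule emeasure_boundary_total[OF irredundant_moment_triangle, where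
        p = "\<lambda>h. if fst h = (-1, 0) then (-1, 2) else if fst h = (0, -1) then (-1, -1) else (2, -1)"])
    fix h assume "h \<in> moment_triangle"
    then show "lattice_edge moment_triangle h (if fst h = (-1, 0) then (-1, 2)
      else if fst h = (0, -1) then (-1, -1) else (2, -1)) 3"
      using moment_triangle_edges by (auto simp: moment_triangle_def)
  qed
  also have "\<dots> = 9" by (simp add: moment_triangle_def)
  finally show ?thesis .
qed

lemma emeasure_dual_pentagon:
  "emeasure (boundary_measure lat_M lat_M (polygon dual_pentagon))
    (frontier (polygon dual_pentagon)) = 11"
proof -
  let ?l = "\<lambda>h. if fst h \<in> {(1, 0), (-1, 0)} then 4 else (1::real)"
  let ?p = "\<lambda>h. if fst h = (1, 0) then (1, 1) else if fst h = (-1, 2) then (1, 5)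
    else if fst h = (-1, 0) then (-1, 4) else if fst h = (-1, -1) then (-1, 0) else (0, -1::real)"
  have "emeasure (boundary_measure lat_M lat_M (polygon dual_pentagon))
      (frontier (polygon dual_pentagon)) = (\<Sum>h\<in>dual_pentagon. ennreal (?l h))"
  proof (rule emeasure_boundary_total[OF irredundant_dual_pentagon])
    fix h assume "h \<in> dual_pentagon"
    then show "lattice_edge dual_pentagon h (?p h) (?l h)"
      using dual_pentagon_edges by (auto simp: dual_pentagon_def)
  qed
  also have "\<dots> = 11" by (simp add: dual_pentagon_def)
  finally show ?thesis .
qed

lemma moment_triangle_lattice_points:
  "polygon moment_triangle \<inter> lat_M =
    {- e0 + 2 *\<^sub>R e1, - e0 + e1, e1, - e0, 0, e0, - e0 - e1, - e1, e0 - e1, 2 *\<^sub>R e0 - e1}"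
  (is "?L = ?R")
proof
  show "?L \<subseteq> ?R"
  proof
    fix m assume "m \<in> ?L"
    then obtain a b :: int where m: "m = (of_int a, of_int b)"
      and "real_of_int (- a) \<le> of_int 1" "real_of_int (- b) \<le> of_int 1"
        "real_of_int (a + b) \<le> of_int 1"
      by (auto simp: mem_lat_M polygon_def moment_triangle_def)
    then have ab: "- a \<le> 1" "- b \<le> 1" "a + b \<le> 1" by (simp_all only: of_int_le_iff)
    then have "b = -1 \<and> (a = -1 \<or> a = 0 \<or> a = 1 \<or> a = 2) \<or> b = 0 \<and> (a = -1 \<or> a = 0 \<or> a = 1) \<or>
      b = 1 \<and> (a = -1 \<or> a = 0) \<or> b = 2 \<and> a = -1"
      by presburger
    then show "m \<in> ?R"
      by (elim disjE conjE) (simp_all add: m e0_def e1_def zero_prod_def)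
  qed
  have "?R \<subseteq> lat_M" by (auto simp: mem_lat_M_iff_Ints e0_def e1_def)
  moreover have "?R \<subseteq> polygon moment_triangle"
    by (auto simp: polygon_def moment_triangle_def e0_def e1_def)
  ultimately show "?R \<subseteq> ?L" by blast
qed

text \<open>Five of the ten inequalities are those of the pentagon; the others are consequences of
  them.  In particular the values 5 of \<open>h\<close> are large enough for \<open>y \<le> x + 5\<close> and \<open>y \<le> 5\<close> to
  touch the pentagon only in the vertices (-1,4) and (1,5), so that the top is a single edge.\<close>

lemma dual_body_eq_pentagon:
  fixes h :: "plane \<Rightarrow> int"
  assumes "h 0 = 0" and "h (- e0 + 2 *\<^sub>R e1) = 9"
    and "h (- e0 + e1) = 5" and "h e1 = 5"
    and "h (- e0) = 1" and "h e0 = 1" and "h (- e0 - e1) = 1"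
    and "h (- e1) = 1" and "h (e0 - e1) = 1" and "h (2 *\<^sub>R e0 - e1) = 1"
  shows "dual_body (polygon moment_triangle) h = polygon dual_pentagon"
  unfolding dual_body_def moment_triangle_lattice_points ball_simps assms
  by (auto simp: polygon_def dual_pentagon_def e0_def e1_def)

section \<open>Non-existence\<close>

lemma rel_interior_lattice_edge:
  assumes "lattice_edge H h p l"
  shows "rel_interior (edge H h) = (\<lambda>u. p + u *\<^sub>R rot (fst h)) ` {0<..<l}"
proof -
  let ?f = "\<lambda>u. u *\<^sub>R rot (fst h)"
  have "rot (fst h) \<noteq> 0" and l: "l > 0"
    and e: "edge H h = (\<lambda>u. p + u *\<^sub>R rot (fst h)) ` {0..l}"
    using assms by (auto simp: lattice_edge_def rot_eq_0_iff coprime_vec_nonzero)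
  then have "inj ?f" by (auto intro!: injI)
  moreover have "bounded_linear ?f" by (rule bounded_linear_scaleR_left)
  ultimately have ri: "rel_interior (?f ` {0..l}) = ?f ` {0<..<l}"
    using l by (simp add: rel_interior_injective_linear_image rel_interior_real_box)
  have "edge H h = (+) p ` ?f ` {0..l}" by (simp add: e image_image)
  then have "rel_interior (edge H h) = (+) p ` ?f ` {0<..<l}"
    by (simp only: rel_interior_translation ri)
  then show ?thesis by (simp add: image_image)
qed

text \<open>A lower bound suffices later on, so the summands of the other facets, which in fact vanish,
  are just discarded.\<close>

lemma boundary_measure_open_edge:
  assumes H: "irredundant H" and e: "lattice_edge H h p l"
  shows "rel_interior (edge H h) \<in> sets (boundary_measure lat_M lat_M (polygon H))"
    and "emeasure (boundary_measure lat_M lat_M (polygon H)) (rel_interior (edge H h)) \<ge> ennreal l"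
proof -
  let ?P = "polygon H" and ?F = "edge H h"
  let ?M = "\<lambda>F. lattice_length (perp_lattice lat_M (prim_normal lat_M ?P F)) F"
  have seg: "?F = (\<lambda>u. p + u *\<^sub>R rot (fst h)) ` {0..l}" and l: "0 \<le> l"
    and nz: "rot (fst h) \<noteq> 0" and "h \<in> H"
    using e by (auto simp: lattice_edge_def rot_eq_0_iff coprime_vec_nonzero)
  note ri = rel_interior_lattice_edge[OF e]
  have ph: "polyhedron ?P" and facet: "?F facet_of ?P"
    using polyhedron_polygon[OF H] \<open>h \<in> H\<close> by auto
  have sub: "rel_interior ?F \<subseteq> ?F" by (rule rel_interior_subset)
  have fr: "rel_interior ?F \<subseteq> frontier ?P" using facet_subset_frontier[OF ph facet] sub by blast
  have b: "rel_interior ?F \<in> sets borel" unfolding ri by (rule borel_segment) auto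
  show "rel_interior ?F \<in> sets (boundary_measure lat_M lat_M ?P)"
    using b fr by (simp add: sets_boundary_measure)
  have "ennreal l = emeasure (?M ?F) (rel_interior ?F \<inter> ?F)"
    using emeasure_lattice_length_segment[OF lattice_gen_edge[OF H e] nz l seg, of "{0<..<l}"]
      sub ri by (simp add: Int_absorb2)
  also have "\<dots> \<le> (\<Sum>F | F facet_of ?P. emeasure (?M F) (rel_interior ?F \<inter> F))"
    using facet finite_polyhedron_facets[OF ph] by (intro member_le_sum) auto
  also have "\<dots> = emeasure (boundary_measure lat_M lat_M ?P) (rel_interior ?F)"
    by (rule emeasure_boundary_measure[OF ph b fr, symmetric])
  finally show "emeasure (boundary_measure lat_M lat_M ?P) (rel_interior ?F) \<ge> ennreal l" .
qed

text \<open>The sign \<open>d\<close> is that of the generator behind \<open>\<beta>\<close>.  On the line \<open>x = -1\<close> the support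
  function of the triangle is at most \<open>1 + max (- y) (2 * y)\<close>, because points of the triangle
  have first coordinate at least -1 and second coordinate between -1 and 2.\<close>

lemma subgradient_left_edge:
  assumes \<Psi>: "\<Psi> \<in> P_class (polygon moment_triangle)" and d: "d \<in> {1, -1}"
    and \<tau>: "\<tau> = (\<lambda>u. (-1, 4 - u)) ` {0<..<4}"
    and \<beta>: "\<And>n. \<beta> n = d * snd n"
  obtains a where
    "(\<Union>s\<in>\<beta> ` \<tau>. subgradient (\<beta> ` \<tau>) (\<Psi> \<circ> inv_into \<tau> \<beta>) s) \<subseteq> {a..a + 3}"
proof -
  have dd: "d * d = 1" using d by auto
  have inj: "inj_on \<beta> \<tau>" using d by (auto simp: inj_on_def \<tau> \<beta>)
  have I: "\<beta> ` \<tau> = (\<lambda>y. d * y) ` {0<..<4}"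
  proof -
    have "\<tau> = Pair (-1) ` (\<lambda>u. 4 - u) ` {0<..<4}" by (simp add: \<tau> image_image)
    also have "(\<lambda>u. 4 - u) ` {0<..<4::real} = {0<..<4}"
      by (auto intro!: image_eqI[of _ _ "4 - x" for x])
    finally show ?thesis by (simp add: \<beta> image_image)
  qed
  have "open (\<beta> ` \<tau>)" unfolding I using d by auto
  \<comment> \<open>Reversing the sign of the coordinate turns the slope range [-1, 2] into [-2, 1].\<close>
  define a where "a = (if d = 1 then -1 else -2::real)"
  define \<phi> where "\<phi> = (\<lambda>t. \<Psi> (-1, d * t))"
  have conv: "convex_on UNIV \<phi>"
  proof (rule convex_onI)
    fix t x y :: real assume "0 < t" "t < 1"
    moreover have "convex_on UNIV \<Psi>" using \<Psi> by (simp add: P_class_def)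
    ultimately have "\<Psi> ((1 - t) *\<^sub>R (-1, d * x) + t *\<^sub>R (-1, d * y))
        \<le> (1 - t) * \<Psi> (-1, d * x) + t * \<Psi> (-1, d * y)"
      by (intro convex_onD) auto
    then show "\<phi> ((1 - t) *\<^sub>R x + t *\<^sub>R y) \<le> (1 - t) * \<phi> x + t * \<phi> y"
      by (simp add: \<phi>_def algebra_simps)
  qed simp
  have "0 \<in> polygon moment_triangle \<inter> lat_M" by (simp add: moment_triangle_lattice_points)
  then have ne: "polygon moment_triangle \<inter> lat_M \<noteq> {}" by blast
  have "m \<bullet> n \<le> 1 + max (- snd n) (2 * snd n)"
    if mn: "m \<in> polygon moment_triangle \<inter> lat_M" "n \<in> {n. fst n = -1}" for m n
  proof -
    obtain x y where "m = (x, y)" by fastforce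
    with mn have m: "m = (x, y)" "- x \<le> 1" "- 1 \<le> y" "y \<le> 2"
      by (auto simp: polygon_def moment_triangle_def)
    have "y * snd n \<le> max (- snd n) (2 * snd n)"
    proof (cases "snd n \<ge> 0")
      case True
      then have "y * snd n \<le> 2 * snd n" using m by (intro mult_right_mono) auto
      then show ?thesis by simp
    next
      case False
      then have "y * snd n \<le> -1 * snd n" using m by (intro mult_right_mono_neg) auto
      then show ?thesis by simp
    qed
    then show ?thesis using m mn by (cases n) auto
  qed
  from P_class_growth[OF \<Psi> ne this]
  obtain C where C: "\<forall>n\<in>{n. fst n = -1}. \<Psi> n \<le> C + (1 + max (- snd n) (2 * snd n))" by blast
  have growth: "\<phi> t \<le> (C + 1) + max (a * t) ((a + 3) * t)" for t
    using bspec[OF C, of "(-1, d * t)"] d by (auto simp: \<phi>_def a_def max.commute)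
  have f: "(\<Psi> \<circ> inv_into \<tau> \<beta>) t = \<phi> t" if t: "t \<in> \<beta> ` \<tau>" for t
  proof -
    obtain n where n: "n \<in> \<tau>" "t = \<beta> n" using t by blast
    then have "n = (-1, d * t)" using dd by (auto simp: \<tau> \<beta> mult.assoc[symmetric])
    moreover have "inv_into \<tau> \<beta> t = n"
      unfolding n(2) by (rule inv_into_f_f[OF inj n(1)])
    ultimately show ?thesis by (simp only: o_def \<phi>_def)
  qed
  have "subgradient (\<beta> ` \<tau>) (\<Psi> \<circ> inv_into \<tau> \<beta>) s \<subseteq> {a..a + 3}" if "s \<in> \<beta> ` \<tau>" for s
    by (rule subgradient_subset_growth[OF _ conv \<open>open (\<beta> ` \<tau>)\<close> that f growth]) auto
  then show ?thesis using that by blast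
qed

theorem lemma21:
  fixes \<Delta> :: "plane set" and h :: "plane \<Rightarrow> int" and c :: ennreal and \<nu> :: "plane measure"
  assumes "\<Delta> = convex hull {- e0 + 2 *\<^sub>R e1, 2 *\<^sub>R e0 - e1, - e0 - e1}"
    and "h 0 = 0" and "h (- e0 + 2 *\<^sub>R e1) = 9"
    and "h (- e0 + e1) = 5" and "h e1 = 5"
    and "h (- e0) = 1" and "h e0 = 1" and "h (- e0 - e1) = 1"
    and "h (- e1) = 1" and "h (e0 - e1) = 1" and "h (2 *\<^sub>R e0 - e1) = 1"
    and "c = emeasure (mu_M \<Delta>) (frontier \<Delta>) / emeasure (nu_N \<Delta> h) (frontier (dual_body \<Delta> h))"
    and "\<nu> = scale_measure c (nu_N \<Delta> h)"
  shows "\<not> (\<exists>\<Psi> \<in> P_class \<Delta>. MA_equation \<Delta> h \<Psi> \<nu>)"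
proof
  assume "\<exists>\<Psi> \<in> P_class \<Delta>. MA_equation \<Delta> h \<Psi> \<nu>"
  then obtain \<Psi> where \<Psi>: "\<Psi> \<in> P_class \<Delta>" and MA: "MA_equation \<Delta> h \<Psi> \<nu>" by blast
  have \<Delta>: "\<Delta> = polygon moment_triangle" using assms(1) moment_triangle_eq_hull by simp
  have dual: "dual_body \<Delta> h = polygon dual_pentagon"
    unfolding \<Delta> by (rule dual_body_eq_pentagon) (rule assms)+
  have nu: "nu_N \<Delta> h = boundary_measure lat_M lat_M (polygon dual_pentagon)"
    by (simp add: nu_N_def dual lat_N_eq_lat_M)
  have "emeasure (mu_M \<Delta>) (frontier \<Delta>) = 9"
    by (simp only: mu_M_def lat_N_eq_lat_M \<Delta> emeasure_moment_triangle)
  moreover have "emeasure (nu_N \<Delta> h) (frontier (dual_body \<Delta> h)) = 11"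
    by (simp only: nu dual emeasure_dual_pentagon)
  ultimately have "c = 9 / 11" using assms(12) by simp
  also have "\<dots> = ennreal (9 / 11)"
    using divide_ennreal[of 9 11] by simp
  finally have c: "c = ennreal (9 / 11)" .

  let ?h = "((-1, 0), 1) :: plane \<times> real"
  define \<tau> where "\<tau> = edge dual_pentagon ?h"
  define \<sigma> where "\<sigma> = edge moment_triangle ?h"
  note \<tau>_edge = dual_pentagon_edges(3) and \<sigma>_edge = moment_triangle_edges(1)
  have facets: "\<tau> facet_of dual_body \<Delta> h" "\<sigma> facet_of \<Delta>"
    using \<tau>_edge \<sigma>_edge polyhedron_polygon(2)[OF irredundant_dual_pentagon]
      polyhedron_polygon(2)[OF irredundant_moment_triangle]
    unfolding dual unfolding \<Delta> \<tau>_def \<sigma>_def lattice_edge_def by blast+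
  have normal: "prim_normal lat_M (dual_body \<Delta> h) \<tau> \<in> \<sigma>"
    unfolding dual \<tau>_def prim_normal_edge[OF irredundant_dual_pentagon \<tau>_edge]
    by (simp add: \<sigma>_def edge_def polygon_def moment_triangle_def)
  have E: "rel_interior \<tau> \<in> sets \<nu>"
    unfolding assms(13) nu \<tau>_def
    by (simp add: boundary_measure_open_edge(1)[OF irredundant_dual_pentagon \<tau>_edge])

  let ?S = "\<Union>s\<in>beta \<Delta> \<sigma> ` rel_interior \<tau>.
    subgradient (beta \<Delta> \<sigma> ` rel_interior \<tau>) (\<Psi> \<circ> inv_into (rel_interior \<tau>) (beta \<Delta> \<sigma>)) s"
  have "lattice_gen (perp_lattice lat_M (prim_normal lat_N \<Delta> \<sigma>)) \<in> {(0, 1), (0, -1)}"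
    using lattice_gen_edge[OF irredundant_moment_triangle \<sigma>_edge]
    by (auto simp: lat_N_eq_lat_M \<Delta> \<sigma>_def rot_def)
  then obtain d :: real where d: "d \<in> {1, -1}"
    and "lattice_gen (perp_lattice lat_M (prim_normal lat_N \<Delta> \<sigma>)) = (0, d)" by blast
  then have \<beta>: "beta \<Delta> \<sigma> n = d * snd n" for n
    by (cases n) (simp add: beta_def)
  have ri: "rel_interior \<tau> = (\<lambda>u. (-1, 4 - u)) ` {0<..<4}"
    unfolding \<tau>_def rel_interior_lattice_edge[OF \<tau>_edge] by (simp add: rot_def)
  obtain a where "?S \<subseteq> {a..a + 3}"
    using subgradient_left_edge[OF \<Psi>[unfolded \<Delta>] d ri \<beta>] by blast
  then have "emeasure lebesgue ?S \<le> emeasure lebesgue {a..a + 3}"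
    by (rule emeasure_mono) simp
  also have "\<dots> = ennreal 3" by simp
  also have "\<dots> < ennreal (9 / 11) * ennreal 4"
    by (simp add: ennreal_mult[symmetric] ennreal_less_iff del: ennreal_numeral)
  also have "\<dots> \<le> emeasure \<nu> (rel_interior \<tau>)"
    using boundary_measure_open_edge(2)[OF irredundant_dual_pentagon \<tau>_edge]
    unfolding assms(13) nu c \<tau>_def by (auto intro: mult_left_mono)
  also have "\<dots> = emeasure lebesgue ?S"
    using MA facets normal E unfolding MA_equation_def by (metis order_refl)
  finally show False by simp
qed

end
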